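(* For each accuracy $\epsilon\in(0,1/2]$ let $(x^k,y^k,u^k)$ be generated by the modified Algorithm (DFG) applied to the regularized dual problem with parameter $\delta=\epsilon/\mathcal{R}_{\mathrm d}^2$, and let $v^k=u(x^k)$. Then the last primal iterate $v^k$ is an $\epsilon$-primal solution of (P) after $k=\mathcal{O}\!\left(\frac{1}{\sqrt{\epsilon}}\log\frac1\epsilon\right)$ iterations; that is, there exist constants $C_1,C_2>0$, independent of $\epsilon$ and $k$, such that for every $\epsilon\in(0,1/2]$ and every integer $k\ge1$ with $k\ge \frac{C_1}{\sqrt\epsilon}\log\frac1\epsilon$, $$\mathrm{dist}_{\mathcal{K}}(Gv^k+g)\le C_2\,\epsilon \quad\text{and}\quad -C_2\,\epsilon\le f(v^k)-f^*\le C_2\,\epsilon .$$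
   Context: Problem (P): $f^* = \min_{u \in U} f(u)$ subject to $Gu + g \in \mathcal{K}$, where $f:\mathbb{R}^n \to \mathbb{R}$ is $\sigma_{\mathrm f}$-strongly convex with respect to the Euclidean norm $\|\cdot\|$ ($\sigma_{\mathrm f}>0$), $G \in \mathbb{R}^{p\times n}$ ($G\ne 0$), $g \in \mathbb{R}^p$, $\mathcal{K}\subseteq\mathbb{R}^p$ is a proper cone (closed, convex, pointed, nonempty interior), and $U \subseteq \mathbb{R}^n$ is a nonempty closed convex set. $\mathcal{K}^* = \{x : \langle x,z\rangle \ge 0\ \forall z\in\mathcal{K}\}$ is the dual cone. The Lagrangian is $\mathcal{L}(u,x) = f(u) - \langle x, Gu+g\rangle$, the dual function is $d(x) = \min_{u\in U}\mathcal{L}(u,x)$ for $x \in \mathbb{R}^p$, and $u(x)$ is the unique minimizer of $\mathcal{L}(\cdot,x)$ over $U$. The function $d$ is concave and differentiable on $\mathbb{R}^p$ with $\nabla d(x) = -Gu(x)-g$, Lipschitz with constant $L_{\mathrm d} = \|G\|^2/\sigma_{\mathrm f}$ ($\|G\|$ the spectral norm). Standing assumption: there exists a finite optimal Lagrange multiplier for the conic constraint, so that $f^* = \max_{x\in\mathcal{K}^*} d(x)$ and the set $X^*\subseteq\mathcal{K}^*$ of maximizers is nonempty. $[z]_C$ denotes Euclidean projection onto $C$ and $\mathrm{dist}_C(z)=\min_{w\in C}\|w-z\|$. For the starting point $x^0\in\mathcal{K}^*$, $\mathcal{R}_{\mathrm d}=\min_{x^*\in X^*}\|x^0-x^*\|$,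 with $\mathcal{R}_{\mathrm d}>0$. Regularized dual problem: $\max_{x\in\mathcal{K}^*}d_\delta(x)$ with $d_\delta(x)=d(x)-\frac\delta2\|x-x^0\|^2$; $d_\delta$ is $\sigma_{\mathrm d,\delta}=\delta$-strongly concave and has Lipschitz gradient with constant $L_{\mathrm d,\delta}=L_{\mathrm d}+\delta$, and $\nabla d_\delta(y)=\nabla d(y)-\delta(y-x^0)$. Modified Algorithm (DFG): start from $x^0=y^1\in\mathcal{K}^*$; for $k\ge1$ compute $u^k=u(y^k)$, $x^k=\left[y^k+\frac{1}{L_{\mathrm d,\delta}}\nabla d_\delta(y^k)\right]_{\mathcal{K}^*}$, and $$y^{k+1}=x^k+\frac{\sqrt{L_{\mathrm d,\delta}}-\sqrt{\sigma_{\mathrm d,\delta}}}{\sqrt{L_{\mathrm d,\delta}}+\sqrt{\sigma_{\mathrm d,\delta}}}\,(x^k-x^{k-1}).$$ $\tilde u\in U$ is an $\epsilon$-primal solution if $\mathrm{dist}_{\mathcal{K}}(G\tilde u+g)\le\mathcal{O}(\epsilon)$ and $-\mathcal{O}(\epsilon)\le f(\tilde u)-f^*\le\mathcal{O}(\epsilon)$; constants in $\mathcal{O}$ may depend on the problem data and $x^0$, but not on $\epsilon$ or $k$. *)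

theory Defs
  imports "HOL-Analysis.Analysis"
begin

definition strongly_convex_on :: "'a::real_normed_vector set \<Rightarrow> real \<Rightarrow> ('a \<Rightarrow> real) \<Rightarrow> bool" where
  "strongly_convex_on S \<sigma> f \<longleftrightarrow> convex S \<and>
    (\<forall>x\<in>S. \<forall>y\<in>S. \<forall>s\<ge>0. \<forall>t\<ge>0. s + t = 1 \<longrightarrow>
      f (s *\<^sub>R x + t *\<^sub>R y) \<le> s * f x + t * f y - \<sigma> / 2 * s * t * (norm (x - y))\<^sup>2)"

definition proper_cone :: "'a::real_normed_vector set \<Rightarrow> bool" where
  "proper_cone K \<longleftrightarrow>
    convex_cone K \<and> closed K \<and> (\<forall>z. z \<in> K \<and> - z \<in> K \<longrightarrow> z = 0) \<and> interior K \<noteq> {}"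

definition dual_cone :: "'a::real_inner set \<Rightarrow> 'a set" where
  "dual_cone K = {x. \<forall>z\<in>K. 0 \<le> x \<bullet> z}"

text \<open>Only meaningful at points of differentiability, where the library relation
  \<^const>\<open>gderiv\<close> determines the gradient uniquely.\<close>
definition gradient :: "('a::real_inner \<Rightarrow> real) \<Rightarrow> 'a \<Rightarrow> 'a" where
  "gradient h x = (THE D. GDERIV h x :> D)"

definition feasible_set ::
  "real^'n^'p \<Rightarrow> real^'p \<Rightarrow> (real^'p) set \<Rightarrow> (real^'n) set \<Rightarrow> (real^'n) set" where
  "feasible_set G g K U = {u \<in> U. G *v u + g \<in> K}"

definition primal_opt ::
  "(real^'n \<Rightarrow> real) \<Rightarrow> real^'n^'p \<Rightarrow> real^'p \<Rightarrow> (real^'p) set \<Rightarrow> (real^'n) set \<Rightarrow> real" where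
  "primal_opt f G g K U = (INF u \<in> feasible_set G g K U. f u)"

definition lagrangian ::
  "(real^'n \<Rightarrow> real) \<Rightarrow> real^'n^'p \<Rightarrow> real^'p \<Rightarrow> real^'n \<Rightarrow> real^'p \<Rightarrow> real" where
  "lagrangian f G g u x = f u - x \<bullet> (G *v u + g)"

text \<open>For strongly convex \<open>f\<close> and nonempty closed convex \<open>U\<close> the Lagrangian has a unique
  minimizer over \<open>U\<close>, so \<open>lagr_argmin\<close> involves no choice and the infimum in
  \<open>dual_fun\<close> is attained there.\<close>
definition lagr_argmin ::
  "(real^'n \<Rightarrow> real) \<Rightarrow> real^'n^'p \<Rightarrow> real^'p \<Rightarrow> (real^'n) set \<Rightarrow> real^'p \<Rightarrow> real^'n" where
  "lagr_argmin f G g U x = arg_min_on (\<lambda>u. lagrangian f G g u x) U"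

definition dual_fun ::
  "(real^'n \<Rightarrow> real) \<Rightarrow> real^'n^'p \<Rightarrow> real^'p \<Rightarrow> (real^'n) set \<Rightarrow> real^'p \<Rightarrow> real" where
  "dual_fun f G g U x = (INF u \<in> U. lagrangian f G g u x)"

definition dual_solutions ::
  "(real^'n \<Rightarrow> real) \<Rightarrow> real^'n^'p \<Rightarrow> real^'p \<Rightarrow> (real^'p) set \<Rightarrow> (real^'n) set \<Rightarrow> (real^'p) set" where
  "dual_solutions f G g K U =
    {x \<in> dual_cone K. \<forall>z \<in> dual_cone K. dual_fun f G g U z \<le> dual_fun f G g U x}"

text \<open>The solution set is closed, so on a nonempty solution set the infimum in
  \<^const>\<open>infdist\<close> is a minimum.\<close>
definition dual_dist ::
  "(real^'n \<Rightarrow> real) \<Rightarrow> real^'n^'p \<Rightarrow> real^'p \<Rightarrow> (real^'p) set \<Rightarrow> (real^'n) set \<Rightarrow> real^'p \<Rightarrow> real" where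
  "dual_dist f G g K U x0 = infdist x0 (dual_solutions f G g K U)"

definition reg_dual ::
  "(real^'n \<Rightarrow> real) \<Rightarrow> real^'n^'p \<Rightarrow> real^'p \<Rightarrow> (real^'n) set \<Rightarrow> real^'p \<Rightarrow> real \<Rightarrow> real^'p \<Rightarrow> real" where
  "reg_dual f G g U x0 \<delta> x = dual_fun f G g U x - \<delta> / 2 * (norm (x - x0))\<^sup>2"

definition reg_lipschitz :: "real^'n^'p \<Rightarrow> real \<Rightarrow> real \<Rightarrow> real" where
  "reg_lipschitz G \<sigma> \<delta> = (onorm (\<lambda>u. G *v u))\<^sup>2 / \<sigma> + \<delta>"

text \<open>The strong concavity modulus of the regularized dual function is \<open>\<delta>\<close>.  The sequences \<open>y\<close>
  and \<open>u\<close> are indexed from 1; their entries at 0 are unconstrained and play no role.\<close>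
definition dfg_iterates ::
  "(real^'n \<Rightarrow> real) \<Rightarrow> real \<Rightarrow> real^'n^'p \<Rightarrow> real^'p \<Rightarrow> (real^'p) set \<Rightarrow> (real^'n) set \<Rightarrow> real^'p \<Rightarrow>
    real \<Rightarrow> (nat \<Rightarrow> real^'p) \<Rightarrow> (nat \<Rightarrow> real^'p) \<Rightarrow> (nat \<Rightarrow> real^'n) \<Rightarrow> bool" where
  "dfg_iterates f \<sigma> G g K U x0 \<delta> x y u \<longleftrightarrow>
    (let L = reg_lipschitz G \<sigma> \<delta> in
      x 0 = x0 \<and> y 1 = x0 \<and>
      (\<forall>k\<ge>1.
        u k = lagr_argmin f G g U (y k) \<and>
        x k = closest_point (dual_cone K)
                (y k + (1 / L) *\<^sub>R gradient (reg_dual f G g U x0 \<delta>) (y k)) \<and>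
        y (k + 1) = x k + ((sqrt L - sqrt \<delta>) / (sqrt L + sqrt \<delta>)) *\<^sub>R (x k - x (k - 1))))"

text \<open>The implicit constant of the \<open>O(\<epsilon>)\<close> bounds is the explicit parameter \<open>C\<close>.\<close>
definition primal_solution ::
  "(real^'n \<Rightarrow> real) \<Rightarrow> real^'n^'p \<Rightarrow> real^'p \<Rightarrow> (real^'p) set \<Rightarrow> (real^'n) set \<Rightarrow>
    real \<Rightarrow> real \<Rightarrow> real^'n \<Rightarrow> bool" where
  "primal_solution f G g K U C \<epsilon> v \<longleftrightarrow>
    v \<in> U \<and> infdist (G *v v + g) K \<le> C * \<epsilon> \<and>
    - (C * \<epsilon>) \<le> f v - primal_opt f G g K U \<and> f v - primal_opt f G g K U \<le> C * \<epsilon>"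

end

theory Submission
  imports Defs
begin

text \<open>The proof follows the dual iterates to the maximiser \<open>m\<close> of the regularised dual
  function and then reads off primal quantities there.

  The dual function \<open>d\<close> is an infimum of affine functions, so it is concave; strong convexity of
  \<open>f\<close> bounds the curvature of \<open>d\<close> from below by \<open>- Ld\<close>, where \<open>Ld\<close> is the squared spectral norm of
  \<open>G\<close> over \<open>\<sigma>\<close> (\<open>dual_fun_upper\<close>, \<open>dual_fun_lower\<close>).  The regularised dual therefore lies
  between two parabolas of curvature \<open>- \<delta>\<close> and \<open>- (Ld + \<delta>)\<close> around each point.  These two
  bounds are the only information about the objective that the analysis of the accelerated
  method uses: a Lyapunov function contracts by the factor \<open>1 - sqrt (\<delta> / (Ld + \<delta>))\<close> in each
  step (\<open>accelerated_step_contraction\<close>).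

  At \<open>m\<close> the optimality conditions hold exactly, up to the gradient \<open>\<delta> (m - x0)\<close> of the
  regulariser: \<open>G u + g + \<delta> (m - x0)\<close>, with \<open>u\<close> the Lagrangian minimiser at \<open>m\<close>, belongs to
  \<open>K\<close> and is orthogonal to \<open>m\<close> (\<open>reg_dual_max_kkt\<close>).  Since \<open>m\<close> is no farther from
  \<open>x0\<close> than any dual solution, \<open>u\<close> has infeasibility and suboptimality of order \<open>\<delta>\<close>,
  hence of order \<open>\<epsilon>\<close>.

  It remains to transfer this to the Lagrangian minimiser at the iterate \<open>x k\<close>.  That minimiser
  depends Lipschitz continuously on the multiplier, so a distance of order \<open>\<epsilon>\<close> between
  \<open>x k\<close> and \<open>m\<close> suffices (\<open>primal_recovery\<close>).  Strong concavity with modulus of order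
  \<open>\<epsilon>\<close> gives such a distance as soon as the dual gap is of order \<open>\<epsilon>\<^sup>3\<close>.  The contraction
  factor is at most \<open>1 - c sqrt \<epsilon>\<close> for a constant \<open>c\<close>, so reaching a gap of that order takes
  about \<open>3 / (c sqrt \<epsilon>) * ln (1 / \<epsilon>)\<close> steps: demanding a higher power of \<open>\<epsilon>\<close> changes only
  the constant.\<close>

section \<open>Minimisers of strongly convex functions\<close>

lemma attains_min_on_closed_if_coercive:
  fixes \<phi> :: "'a::heine_borel \<Rightarrow> real"
  assumes "continuous_on S \<phi>" "closed S" "w \<in> S"
    and far: "\<And>u. u \<in> S \<Longrightarrow> r < dist w u \<Longrightarrow> \<phi> w \<le> \<phi> u"
  shows "\<exists>m\<in>S. \<forall>u\<in>S. \<phi> m \<le> \<phi> u"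
proof -
  let ?B = "S \<inter> cball w (max r 0)"
  have "compact ?B" "?B \<noteq> {}" "continuous_on ?B \<phi>"
    using assms by (auto intro: closed_Int_compact continuous_on_subset)
  from continuous_attains_inf[OF this]
  obtain m where m: "m \<in> ?B" "\<And>u. u \<in> ?B \<Longrightarrow> \<phi> m \<le> \<phi> u" by blast
  have "\<phi> m \<le> \<phi> u" if "u \<in> S" for u
  proof (cases "r < dist w u")
    case True
    then show ?thesis using far[OF that] m(2)[of w] \<open>w \<in> S\<close> by force
  qed (use m(2) that in auto)
  with m(1) show ?thesis by blast
qed

lemma strongly_convex_onD:
  assumes "strongly_convex_on S \<sigma> \<phi>" "x \<in> S" "y \<in> S" "0 \<le> s" "0 \<le> t" "s + t = 1"
  shows "\<phi> (s *\<^sub>R x + t *\<^sub>R y) \<le> s * \<phi> x + t * \<phi> y - \<sigma> / 2 * s * t * (norm (x - y))\<^sup>2"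
  using assms by (simp add: strongly_convex_on_def)

lemma strongly_convex_on_imp_convex_on:
  assumes "strongly_convex_on S \<sigma> \<phi>" "\<sigma> \<ge> 0"
  shows "convex_on S \<phi>"
  unfolding convex_on_def
proof (intro conjI ballI allI impI)
  show "convex S" using assms(1) by (simp add: strongly_convex_on_def)
  fix x y and s t :: real
  assume "x \<in> S" "y \<in> S" "0 \<le> s" "0 \<le> t" "s + t = 1"
  note strongly_convex_onD[OF assms(1) this]
  moreover have "0 \<le> \<sigma> / 2 * s * t * (norm (x - y))\<^sup>2"
    using \<open>0 \<le> s\<close> \<open>0 \<le> t\<close> \<open>\<sigma> \<ge> 0\<close> by simp
  ultimately show "\<phi> (s *\<^sub>R x + t *\<^sub>R y) \<le> s * \<phi> x + t * \<phi> y" by linarith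
qed

text \<open>Along any ray the function lies above a parabola: its value at the point of the ray at
  distance 1 is bounded below by compactness, and strong convexity propagates that bound outwards
  with a quadratic gain that eventually beats the linear loss.\<close>
lemma strongly_convex_attains_min:
  fixes \<phi> :: "'a::euclidean_space \<Rightarrow> real"
  assumes sc: "strongly_convex_on UNIV \<sigma> \<phi>" and "\<sigma> > 0" and "closed U" "U \<noteq> {}"
  shows "\<exists>m\<in>U. \<forall>u\<in>U. \<phi> m \<le> \<phi> u"
proof -
  have cont: "continuous_on UNIV \<phi>"
    using strongly_convex_on_imp_convex_on[OF sc] \<open>\<sigma> > 0\<close> by (intro convex_on_continuous) auto
  obtain w where "w \<in> U" using \<open>U \<noteq> {}\<close> by blast
  have "continuous_on (cball w 1) \<phi>" using cont by (rule continuous_on_subset) simp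
  from continuous_attains_inf[OF compact_cball _ this]
  obtain b where b: "\<And>z. z \<in> cball w 1 \<Longrightarrow> \<phi> b \<le> \<phi> z"
    by (metis cball_eq_empty not_one_less_zero)
  define c where "c = \<phi> w - \<phi> b"
  have "c \<ge> 0" using b[of w] by (simp add: c_def)
  have "\<phi> w \<le> \<phi> u" if far: "1 + 2 * c / \<sigma> < dist w u" for u
  proof -
    define r where "r = dist w u"
    define z where "z = (1 - 1 / r) *\<^sub>R w + (1 / r) *\<^sub>R u"
    have "1 + 2 * c / \<sigma> < r" using far by (simp add: r_def)
    moreover have "0 \<le> 2 * c / \<sigma>" using \<open>c \<ge> 0\<close> \<open>\<sigma> > 0\<close> by simp
    ultimately have "r > 1" by linarith
    have "z - w = (1 / r) *\<^sub>R (u - w)" by (simp add: z_def algebra_simps)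
    then have "norm (z - w) = (1 / r) * norm (u - w)" using \<open>r > 1\<close> by simp
    also have "norm (u - w) = r" by (simp add: r_def dist_norm norm_minus_commute)
    finally have "dist w z = (1 / r) * r" by (simp add: dist_norm norm_minus_commute)
    then have "\<phi> b \<le> \<phi> z" using \<open>r > 1\<close> b[of z] by simp
    also have "\<phi> z \<le> (1 - 1 / r) * \<phi> w + (1 / r) * \<phi> u - \<sigma> / 2 * (1 - 1 / r) * (1 / r) * r\<^sup>2"
    proof -
      have "0 \<le> 1 - 1 / r" "0 \<le> 1 / r" using \<open>r > 1\<close> by simp_all
      then show ?thesis
        unfolding z_def using strongly_convex_onD[OF sc, of w u "1 - 1 / r" "1 / r"]
        by (simp add: r_def dist_norm)
    qed
    finally have "r * \<phi> b \<le> r * ((1 - 1 / r) * \<phi> w + (1 / r) * \<phi> u - \<sigma> / 2 * (1 - 1 / r) * (1 / r) * r\<^sup>2)"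
      using \<open>r > 1\<close> by (intro mult_left_mono) auto
    also have "\<dots> = (r - 1) * \<phi> w + \<phi> u - \<sigma> / 2 * (r - 1) * r"
      using \<open>r > 1\<close> by (simp add: field_simps power2_eq_square)
    finally have *: "\<phi> w + r * (\<sigma> / 2 * (r - 1) - c) \<le> \<phi> u"
      by (simp add: c_def algebra_simps)
    have "2 * c / \<sigma> \<le> r - 1" using far by (simp add: r_def)
    then have "c \<le> \<sigma> / 2 * (r - 1)" using \<open>\<sigma> > 0\<close> by (simp add: field_simps)
    then have "0 \<le> r * (\<sigma> / 2 * (r - 1) - c)" using \<open>r > 1\<close> by simp
    with * show ?thesis by linarith
  qed
  then show ?thesis
    using attains_min_on_closed_if_coercive[of U \<phi> w "1 + 2 * c / \<sigma>"]
      continuous_on_subset[OF cont] \<open>closed U\<close> \<open>w \<in> U\<close> by blast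
qed

lemma strongly_convex_growth_at_min:
  assumes sc: "strongly_convex_on S \<sigma> \<phi>" and "convex U" "U \<subseteq> S"
    and "m \<in> U" "\<And>u. u \<in> U \<Longrightarrow> \<phi> m \<le> \<phi> u" and "u \<in> U"
  shows "\<phi> m + \<sigma> / 2 * (norm (u - m))\<^sup>2 \<le> \<phi> u"
proof -
  have "s * (\<sigma> / 2 * (norm (u - m))\<^sup>2) \<le> \<phi> u - \<phi> m" if "0 < s" "s < 1" for s
  proof -
    have "\<phi> m \<le> \<phi> (s *\<^sub>R m + (1 - s) *\<^sub>R u)"
      using assms that by (intro assms(5) convexD) auto
    also have "\<dots> \<le> s * \<phi> m + (1 - s) * \<phi> u - \<sigma> / 2 * s * (1 - s) * (norm (m - u))\<^sup>2"
    proof -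
      have "m \<in> S" "u \<in> S" using assms by auto
      with that show ?thesis by (intro strongly_convex_onD[OF sc]) auto
    qed
    finally have "(1 - s) * (s * (\<sigma> / 2 * (norm (u - m))\<^sup>2)) \<le> (1 - s) * (\<phi> u - \<phi> m)"
      by (simp add: algebra_simps norm_minus_commute)
    then show ?thesis using that by simp
  qed
  then have "\<sigma> / 2 * (norm (u - m))\<^sup>2 \<le> \<phi> u - \<phi> m" by (rule field_le_mult_one_interval)
  then show ?thesis by simp
qed

text \<open>A quadratic upper bound at the minimiser replaces differentiability: the step of length
  \<open>t\<close> towards \<open>z\<close> changes the value by at most \<open>t (p \<bullet> (z - m))\<close> plus a term of order
  \<open>t\<^sup>2\<close>, which cannot compensate a negative slope for small \<open>t\<close>.\<close>
lemma first_order_optimality: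
  fixes p :: "'a::real_inner"
  assumes "convex Q" "m \<in> Q" "z \<in> Q" and min: "\<And>z. z \<in> Q \<Longrightarrow> \<phi> m \<le> \<phi> z"
    and upper: "\<And>z. \<phi> z \<le> \<phi> m + p \<bullet> (z - m) + L / 2 * (norm (z - m))\<^sup>2"
  shows "0 \<le> p \<bullet> (z - m)"
proof (rule ccontr)
  define a where "a = - (p \<bullet> (z - m))"
  define b where "b = L / 2 * (norm (z - m))\<^sup>2"
  have small: "a \<le> t * b" if "0 < t" "t \<le> 1" for t
  proof -
    have eq: "(1 - t) *\<^sub>R m + t *\<^sub>R z - m = t *\<^sub>R (z - m)" by (simp add: algebra_simps)
    have "\<phi> m \<le> \<phi> ((1 - t) *\<^sub>R m + t *\<^sub>R z)"
      using assms that by (intro min convexD) auto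
    also have "\<dots> \<le> \<phi> m + t * (p \<bullet> (z - m)) + L / 2 * (t * norm (z - m))\<^sup>2"
      using upper[of "(1 - t) *\<^sub>R m + t *\<^sub>R z"] that unfolding eq by simp
    finally have "t * a \<le> t * (t * b)"
      by (simp add: a_def b_def power_mult_distrib power2_eq_square algebra_simps)
    with that show ?thesis by simp
  qed
  assume "\<not> 0 \<le> p \<bullet> (z - m)"
  then have "a > 0" by (simp add: a_def)
  with small[of 1] have "b \<ge> a" "b > 0" by auto
  with small[of "a / (2 * b)"] \<open>a > 0\<close> show False by (simp add: field_simps)
qed

lemma gderiv_of_quadratic_bound:
  fixes h :: "'a::real_inner \<Rightarrow> real"
  assumes bound: "\<And>z. \<bar>h z - h y - D \<bullet> (z - y)\<bar> \<le> c * (norm (z - y))\<^sup>2"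
  shows "GDERIV h y :> D"
  unfolding gderiv_def
proof (rule has_derivativeI_sandwich[where e = 1 and H = "\<lambda>z. c * norm (z - y)"])
  show "bounded_linear (\<lambda>h. h \<bullet> D)" by (rule bounded_linear_inner_left)
  fix z assume "z \<noteq> y"
  then show "norm (h z - h y - (z - y) \<bullet> D) / norm (z - y) \<le> c * norm (z - y)"
    using bound[of z] by (simp add: field_simps power2_eq_square inner_commute)
next
  have "((\<lambda>z. c * norm (z - y)) \<longlongrightarrow> c * norm (y - y)) (at y)" by (intro tendsto_intros)
  then show "((\<lambda>z. c * norm (z - y)) \<longlongrightarrow> 0) (at y)" by simp
qed simp

lemma gradient_eqI:
  assumes "GDERIV h y :> D"
  shows "gradient h y = D"
  unfolding gradient_def
proof (rule the_equality[where P = "\<lambda>D. GDERIV h y :> D", OF assms])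
  fix E assume "GDERIV h y :> E"
  with assms have "(\<lambda>v. v \<bullet> E) = (\<lambda>v. v \<bullet> D)"
    unfolding gderiv_def by (rule has_derivative_unique[rotated])
  then have "(E - D) \<bullet> E = (E - D) \<bullet> D" by (rule fun_cong)
  then have "(E - D) \<bullet> (E - D) = 0" by (simp add: inner_diff_right)
  then show "E = D" by simp
qed

section \<open>Linear convergence of the accelerated projected gradient method\<close>

text \<open>The quadratic model of \<open>\<phi>\<close> at \<open>y\<close> in which \<open>L (y - x)\<close> plays the role of the gradient.  It
  comes from the variational inequality of the projection, which compares \<open>L (y - x)\<close> with \<open>p\<close>
  in every direction pointing from \<open>x\<close> into \<open>Q\<close>.\<close>
lemma projected_gradient_step_bound:
  fixes \<phi> :: "'a::euclidean_space \<Rightarrow> real"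
  assumes Q: "convex Q" "closed Q" "z \<in> Q" and "L > 0"
    and lower: "\<phi> z \<ge> \<phi> y + p \<bullet> (z - y) + \<mu> / 2 * (norm (z - y))\<^sup>2"
    and upper: "\<And>w. \<phi> w \<le> \<phi> y + p \<bullet> (w - y) + L / 2 * (norm (w - y))\<^sup>2"
    and x: "x = closest_point Q (y - (1 / L) *\<^sub>R p)"
  shows "\<phi> x + L * ((y - x) \<bullet> (z - y)) + L / 2 * (norm (y - x))\<^sup>2 + \<mu> / 2 * (norm (z - y))\<^sup>2
      \<le> \<phi> z"
proof -
  have "(y - (1 / L) *\<^sub>R p - x) \<bullet> (z - x) \<le> 0"
    using closest_point_dot[OF Q(1,2,3)] by (simp add: x)
  then have "L * ((y - (1 / L) *\<^sub>R p - x) \<bullet> (z - x)) \<le> 0"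
    using \<open>L > 0\<close> by (simp add: mult_le_0_iff)
  then have "L * ((y - x) \<bullet> (z - x)) \<le> p \<bullet> (z - x)"
    using \<open>L > 0\<close> by (simp add: inner_diff_left algebra_simps)
  moreover have "(y - x) \<bullet> (z - x) = (y - x) \<bullet> (z - y) + (norm (y - x))\<^sup>2"
    by (simp add: power2_norm_eq_inner inner_simps algebra_simps)
  then have "L * ((y - x) \<bullet> (z - x)) = L * ((y - x) \<bullet> (z - y)) + L * (norm (y - x))\<^sup>2"
    by (simp add: distrib_left)
  moreover have "p \<bullet> (z - x) = p \<bullet> (z - y) - p \<bullet> (x - y)" by (simp add: inner_simps)
  ultimately show ?thesis
    using lower upper[of x] unfolding norm_minus_commute[of x y] by linarith
qed

text \<open>The Lyapunov function of the method is the gap in value plus a multiple of the squared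
  distance from the auxiliary point \<open>v\<close> to \<open>z\<close>.  Since
  \<open>v' - z = (1 - \<theta>) (v - z) + \<theta> (y - z) - (1 / \<theta>) (y - x')\<close>, expanding the new squared
  distance produces a term linear and a term quadratic in \<open>y - x'\<close>.  The gradient-step bounds at
  the old iterate \<open>x\<close> and at the comparison point \<open>z\<close>, combined with weights \<open>1 - \<theta>\<close> and
  \<open>\<theta>\<close>, produce the opposite terms: the quadratic ones cancel because \<open>\<mu> = L \<theta>\<^sup>2\<close>, the
  linear ones because \<open>y\<close> is chosen as the weighted mean of \<open>v\<close> and \<open>x\<close>.\<close>
lemma accelerated_step_contraction:
  fixes \<phi> :: "'a::euclidean_space \<Rightarrow> real"
  assumes Q: "convex Q" "closed Q" "z \<in> Q" "x \<in> Q"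
    and "L > 0" and \<theta>: "0 < \<theta>" "\<theta> \<le> 1" and \<mu>: "\<mu> = L * \<theta>\<^sup>2"
    and lower: "\<And>w. \<phi> w \<ge> \<phi> y + p \<bullet> (w - y) + \<mu> / 2 * (norm (w - y))\<^sup>2"
    and upper: "\<And>w. \<phi> w \<le> \<phi> y + p \<bullet> (w - y) + L / 2 * (norm (w - y))\<^sup>2"
    and y: "(1 + \<theta>) *\<^sub>R y = \<theta> *\<^sub>R v + x"
    and x': "x' = closest_point Q (y - (1 / L) *\<^sub>R p)"
    and v': "v' = x + (1 / \<theta>) *\<^sub>R (x' - x)"
  shows "\<phi> x' - \<phi> z + \<mu> / 2 * (norm (v' - z))\<^sup>2
      \<le> (1 - \<theta>) * (\<phi> x - \<phi> z + \<mu> / 2 * (norm (v - z))\<^sup>2)"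
proof -
  define a where "a = v - z"
  define b where "b = y - z"
  define e where "e = y - x'"
  have "\<mu> \<ge> 0" using \<mu> \<open>L > 0\<close> by simp
  have at_z: "\<phi> x' - L * (e \<bullet> b) + L / 2 * (e \<bullet> e) + \<mu> / 2 * (b \<bullet> b) \<le> \<phi> z"
    using projected_gradient_step_bound[OF Q(1,2,3) \<open>L > 0\<close> lower upper x']
    by (simp add: b_def e_def power2_norm_eq_inner inner_simps algebra_simps)
  have x: "x - y = \<theta> *\<^sub>R (b - a)" "x = (1 + \<theta>) *\<^sub>R y - \<theta> *\<^sub>R v"
    using y by (simp_all add: a_def b_def algebra_simps)
  have "\<phi> x' + L * (e \<bullet> (x - y)) + L / 2 * (e \<bullet> e) + \<mu> / 2 * (norm (x - y))\<^sup>2 \<le> \<phi> x"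
    using projected_gradient_step_bound[OF Q(1,2,4) \<open>L > 0\<close> lower upper x']
    by (simp add: e_def power2_norm_eq_inner)
  moreover have "0 \<le> \<mu> / 2 * (norm (x - y))\<^sup>2" using \<open>\<mu> \<ge> 0\<close> by simp
  ultimately have "\<phi> x' + L * (e \<bullet> (x - y)) + L / 2 * (e \<bullet> e) \<le> \<phi> x" by linarith
  then have at_x: "\<phi> x' + L * \<theta> * (e \<bullet> b - e \<bullet> a) + L / 2 * (e \<bullet> e) \<le> \<phi> x"
    unfolding x(1) by (simp add: inner_simps algebra_simps)
  have "\<theta> *\<^sub>R (v' - z) = \<theta> *\<^sub>R ((1 - \<theta>) *\<^sub>R a + \<theta> *\<^sub>R b) - e"
    using \<theta> unfolding v' a_def b_def e_def x(2) by (simp add: algebra_simps power2_eq_square)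
  then have "(norm (\<theta> *\<^sub>R (v' - z)))\<^sup>2 = (norm (\<theta> *\<^sub>R ((1 - \<theta>) *\<^sub>R a + \<theta> *\<^sub>R b) - e))\<^sup>2"
    by simp
  also have "(norm (\<theta> *\<^sub>R m - e))\<^sup>2 = \<theta>\<^sup>2 * (norm m)\<^sup>2 - 2 * \<theta> * (e \<bullet> m) + e \<bullet> e" for m
    unfolding power2_norm_eq_inner
    by (simp add: inner_simps inner_commute algebra_simps power2_eq_square)
  finally have "\<theta>\<^sup>2 * (norm (v' - z))\<^sup>2
      = \<theta>\<^sup>2 * (norm ((1 - \<theta>) *\<^sub>R a + \<theta> *\<^sub>R b))\<^sup>2
        - 2 * \<theta> * (e \<bullet> ((1 - \<theta>) *\<^sub>R a + \<theta> *\<^sub>R b)) + e \<bullet> e"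
    by (simp add: power_mult_distrib)
  moreover have "(norm ((1 - \<theta>) *\<^sub>R a + \<theta> *\<^sub>R b))\<^sup>2
      = (1 - \<theta>) * (a \<bullet> a) + \<theta> * (b \<bullet> b) - \<theta> * (1 - \<theta>) * (norm (a - b))\<^sup>2"
    unfolding power2_norm_eq_inner
    by (simp add: inner_simps inner_commute algebra_simps power2_eq_square)
  moreover have "0 \<le> \<theta> * (1 - \<theta>) * (norm (a - b))\<^sup>2" using \<theta> by simp
  ultimately have "\<theta>\<^sup>2 * (norm (v' - z))\<^sup>2
      \<le> \<theta>\<^sup>2 * ((1 - \<theta>) * (a \<bullet> a) + \<theta> * (b \<bullet> b))
        - 2 * \<theta> * ((1 - \<theta>) * (e \<bullet> a) + \<theta> * (e \<bullet> b)) + e \<bullet> e"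
    using mult_left_mono[of "(norm ((1 - \<theta>) *\<^sub>R a + \<theta> *\<^sub>R b))\<^sup>2" "(1 - \<theta>) * (a \<bullet> a) + \<theta> * (b \<bullet> b)" "\<theta>\<^sup>2"]
    by (simp add: inner_simps)
  from mult_left_mono[OF this, of "L / 2"] \<open>L > 0\<close>
  have "\<mu> / 2 * (norm (v' - z))\<^sup>2
      \<le> \<mu> / 2 * ((1 - \<theta>) * (a \<bullet> a) + \<theta> * (b \<bullet> b))
        - L * \<theta> * ((1 - \<theta>) * (e \<bullet> a) + \<theta> * (e \<bullet> b)) + L / 2 * (e \<bullet> e)"
    unfolding \<mu> by (simp add: algebra_simps add_divide_distrib)
  moreover have "(1 - \<theta>) * (\<phi> x' + L * \<theta> * (e \<bullet> b - e \<bullet> a) + L / 2 * (e \<bullet> e))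
      + \<theta> * (\<phi> x' - L * (e \<bullet> b) + L / 2 * (e \<bullet> e) + \<mu> / 2 * (b \<bullet> b))
      \<le> (1 - \<theta>) * \<phi> x + \<theta> * \<phi> z"
    using at_x at_z \<theta> by (intro add_mono mult_left_mono) auto
  ultimately show ?thesis
    unfolding a_def[symmetric] power2_norm_eq_inner[of a]
    by (simp add: algebra_simps power2_eq_square add_divide_distrib diff_divide_distrib)
qed

text \<open>The extrapolation factor is \<open>(1 - \<theta>) / (1 + \<theta>)\<close> for \<open>\<theta> = sqrt (\<mu> / L)\<close>, which
  is what makes every \<open>y (k + 1)\<close> the weighted mean of \<open>x k\<close> and the auxiliary point \<open>v k\<close>
  that the contraction requires.\<close>
lemma accelerated_gradient_linear_rate:
  fixes \<phi> :: "'a::euclidean_space \<Rightarrow> real" and p :: "'a \<Rightarrow> 'a"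
  assumes Q: "convex Q" "closed Q" "z \<in> Q" "x 0 \<in> Q"
    and \<mu>: "0 < \<mu>" "\<mu> \<le> L"
    and lower: "\<And>y w. \<phi> w \<ge> \<phi> y + p y \<bullet> (w - y) + \<mu> / 2 * (norm (w - y))\<^sup>2"
    and upper: "\<And>y w. \<phi> w \<le> \<phi> y + p y \<bullet> (w - y) + L / 2 * (norm (w - y))\<^sup>2"
    and start: "y 1 = x 0"
    and x: "\<And>k. k \<ge> 1 \<Longrightarrow> x k = closest_point Q (y k - (1 / L) *\<^sub>R p (y k))"
    and y: "\<And>k. k \<ge> 1 \<Longrightarrow>
      y (k + 1) = x k + ((sqrt L - sqrt \<mu>) / (sqrt L + sqrt \<mu>)) *\<^sub>R (x k - x (k - 1))"
  shows "\<phi> (x k) - \<phi> z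
      \<le> (1 - sqrt (\<mu> / L)) ^ k * (\<phi> (x 0) - \<phi> z + \<mu> / 2 * (norm (x 0 - z))\<^sup>2)"
proof -
  define \<theta> where "\<theta> = sqrt (\<mu> / L)"
  have "L > 0" using \<mu> by simp
  have \<theta>: "0 < \<theta>" "\<theta> \<le> 1" "\<mu> = L * \<theta>\<^sup>2"
    using \<mu> \<open>L > 0\<close> by (auto simp: \<theta>_def)
  have "sqrt \<mu> = \<theta> * sqrt L" using \<open>L > 0\<close> by (simp add: \<theta>_def real_sqrt_divide)
  then have "(sqrt L - sqrt \<mu>) / (sqrt L + sqrt \<mu>)
      = (sqrt L * (1 - \<theta>)) / (sqrt L * (1 + \<theta>))" by (simp add: algebra_simps)
  then have \<beta>: "(sqrt L - sqrt \<mu>) / (sqrt L + sqrt \<mu>) = (1 - \<theta>) / (1 + \<theta>)"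
    using \<open>L > 0\<close> by simp
  have xQ: "x k \<in> Q" for k
    using Q x[of k] closest_point_in_set[of Q] by (cases "k = 0") auto
  \<comment> \<open>Truncated subtraction makes \<open>v 0 = x 0\<close> and lets the recursion for \<open>y\<close> start at 0.\<close>
  define v where "v k = x k + (1 / \<theta> - 1) *\<^sub>R (x k - x (k - 1))" for k
  have y': "y (Suc k) = x k + ((1 - \<theta>) / (1 + \<theta>)) *\<^sub>R (x k - x (k - 1))" for k
    using y[of k] start \<beta> by (cases "k = 0") auto
  have coupling: "(1 + \<theta>) *\<^sub>R y (Suc k) = \<theta> *\<^sub>R v k + x k" for k
    using \<theta> unfolding y' v_def by (simp add: scaleR_add_right scaleR_left_distrib[symmetric] mult.commute)
      (simp add: algebra_simps)
  have v_Suc: "v (Suc k) = x k + (1 / \<theta>) *\<^sub>R (x (Suc k) - x k)" for k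
    by (simp add: v_def algebra_simps)
  define E where "E k = \<phi> (x k) - \<phi> z + \<mu> / 2 * (norm (v k - z))\<^sup>2" for k
  have step: "E (Suc k) \<le> (1 - \<theta>) * E k" for k
    unfolding E_def
    by (rule accelerated_step_contraction[OF Q(1,2,3) xQ \<open>L > 0\<close> \<theta> lower upper coupling x v_Suc]) simp
  have "E k \<le> (1 - \<theta>) ^ k * E 0"
  proof (induction k)
    case (Suc k)
    have "E (Suc k) \<le> (1 - \<theta>) * E k" by (rule step)
    also have "\<dots> \<le> (1 - \<theta>) * ((1 - \<theta>) ^ k * E 0)"
      using Suc \<theta> by (intro mult_left_mono) auto
    finally show ?case by simp
  qed simp
  moreover have "\<phi> (x k) - \<phi> z \<le> E k" using \<mu> by (simp add: E_def)
  ultimately show ?thesis by (simp add: E_def v_def \<theta>_def)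
qed

section \<open>The dual function\<close>

locale strongly_convex_program =
  fixes f :: "real^'n \<Rightarrow> real" and \<sigma> :: real
    and G :: "real^'n^'p" and g :: "real^'p" and U :: "(real^'n) set"
  assumes \<sigma>_pos: "\<sigma> > 0" and f_strongly_convex: "strongly_convex_on UNIV \<sigma> f"
    and U_nonempty: "U \<noteq> {}" and U_closed: "closed U" and U_convex: "convex U"
begin

abbreviation "umin x \<equiv> lagr_argmin f G g U x"
abbreviation "d x \<equiv> dual_fun f G g U x"

text \<open>The residual of the conic constraint.  At \<open>umin x\<close> it is minus the gradient of \<open>d\<close> at
  \<open>x\<close>.\<close>
definition "res u = G *v u + g"

text \<open>The Lipschitz constant of the gradient of \<open>d\<close>.\<close>
definition "Ld = (onorm (\<lambda>u. G *v u))\<^sup>2 / \<sigma>"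

lemma Ld_nonneg: "0 \<le> Ld"
  using \<sigma>_pos by (simp add: Ld_def)

lemma res_diff: "res u - res v = G *v (u - v)"
  by (simp add: res_def matrix_vector_mult_diff_distrib)

lemma norm_res_diff_le: "norm (res u - res v) \<le> onorm (\<lambda>u. G *v u) * norm (u - v)"
  unfolding res_diff by (rule onorm) simp

lemma lagrangian_strongly_convex:
  "strongly_convex_on UNIV \<sigma> (\<lambda>u. lagrangian f G g u x)"
  unfolding strongly_convex_on_def lagrangian_def
proof (intro conjI ballI allI impI)
  fix u v and s t :: real
  assume st: "0 \<le> s" "0 \<le> t" "s + t = 1"
  then have "t = 1 - s" by simp
  then have "G *v (s *\<^sub>R u + t *\<^sub>R v) + g = s *\<^sub>R (G *v u + g) + t *\<^sub>R (G *v v + g)"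
    unfolding \<open>t = 1 - s\<close> by (simp add: algebra_simps)
  moreover have "f (s *\<^sub>R u + t *\<^sub>R v)
      \<le> s * f u + t * f v - \<sigma> / 2 * s * t * (norm (u - v))\<^sup>2"
    using f_strongly_convex st by (simp add: strongly_convex_on_def)
  ultimately show "f (s *\<^sub>R u + t *\<^sub>R v) - x \<bullet> (G *v (s *\<^sub>R u + t *\<^sub>R v) + g)
      \<le> s * (f u - x \<bullet> (G *v u + g)) + t * (f v - x \<bullet> (G *v v + g))
        - \<sigma> / 2 * s * t * (norm (u - v))\<^sup>2"
    by (simp add: inner_add_right right_diff_distrib)
qed simp

lemma umin_minimizes:
  "umin x \<in> U" "u \<in> U \<Longrightarrow> lagrangian f G g (umin x) x \<le> lagrangian f G g u x"
proof -
  obtain m where "m \<in> U" "\<And>u. u \<in> U \<Longrightarrow> lagrangian f G g m x \<le> lagrangian f G g u x"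
    using strongly_convex_attains_min[OF lagrangian_strongly_convex \<sigma>_pos U_closed U_nonempty]
    by blast
  then have "umin x \<in> U \<and> (\<forall>u\<in>U. lagrangian f G g (umin x) x \<le> lagrangian f G g u x)"
    unfolding lagr_argmin_def arg_min_on_def
    by (intro arg_minI[where x = m and P = "\<lambda>u. u \<in> U"
        and Q = "\<lambda>v. v \<in> U \<and> (\<forall>u\<in>U. lagrangian f G g v x \<le> lagrangian f G g u x)"])
      (auto simp: not_less)
  then show "umin x \<in> U" "u \<in> U \<Longrightarrow> lagrangian f G g (umin x) x \<le> lagrangian f G g u x"
    by auto
qed

lemma dual_fun_eq: "d x = f (umin x) - x \<bullet> res (umin x)"
proof -
  have "d x = lagrangian f G g (umin x) x"
    unfolding dual_fun_def using umin_minimizes(1)[of x] umin_minimizes(2)[of _ x] by (intro cInf_eq_minimum) auto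
  then show ?thesis by (simp add: lagrangian_def res_def)
qed

lemma lagrangian_growth:
  assumes "u \<in> U"
  shows "d x + \<sigma> / 2 * (norm (u - umin x))\<^sup>2 \<le> f u - x \<bullet> res u"
proof -
  have "lagrangian f G g (umin x) x + \<sigma> / 2 * (norm (u - umin x))\<^sup>2 \<le> lagrangian f G g u x"
    using assms umin_minimizes U_convex
    by (intro strongly_convex_growth_at_min[OF lagrangian_strongly_convex U_convex]) auto
  then show ?thesis by (simp add: dual_fun_eq lagrangian_def res_def)
qed

lemma dual_fun_le: "u \<in> U \<Longrightarrow> d x \<le> f u - x \<bullet> res u"
  using umin_minimizes(2) by (simp add: dual_fun_eq lagrangian_def res_def)

text \<open>Each of the two minimisers is tested against the growth of the other's Lagrangian.  The
  sum of the two inequalities leaves only the bilinear coupling of multiplier and residual.\<close>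
lemma umin_lipschitz: "\<sigma> * norm (umin x - umin y) \<le> onorm (\<lambda>u. G *v u) * norm (x - y)"
proof (cases "umin x = umin y")
  case False
  let ?n = "norm (umin x - umin y)"
  have "\<sigma> * ?n\<^sup>2 \<le> (x - y) \<bullet> (res (umin x) - res (umin y))"
    using lagrangian_growth[OF umin_minimizes(1), of y x]
      lagrangian_growth[OF umin_minimizes(1), of x y]
    by (simp add: dual_fun_eq inner_simps norm_minus_commute)
  also have "\<dots> \<le> norm (x - y) * norm (res (umin x) - res (umin y))"
    by (rule norm_cauchy_schwarz)
  also have "\<dots> \<le> norm (x - y) * (onorm (\<lambda>u. G *v u) * ?n)"
    by (intro mult_left_mono norm_res_diff_le) simp
  finally have "?n * (\<sigma> * ?n) \<le> ?n * (onorm (\<lambda>u. G *v u) * norm (x - y))"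
    by (simp add: power2_eq_square algebra_simps)
  then show ?thesis using False by simp
qed (simp add: onorm_pos_le)

lemma res_umin_lipschitz: "norm (res (umin x) - res (umin y)) \<le> Ld * norm (x - y)"
proof -
  have "norm (res (umin x) - res (umin y)) \<le> onorm (\<lambda>u. G *v u) * norm (umin x - umin y)"
    by (rule norm_res_diff_le)
  also have "\<dots> \<le> onorm (\<lambda>u. G *v u) * (onorm (\<lambda>u. G *v u) * norm (x - y) / \<sigma>)"
    using umin_lipschitz[of x y] \<sigma>_pos
    by (intro mult_left_mono) (simp_all add: pos_le_divide_eq mult.commute onorm_pos_le)
  finally show ?thesis by (simp add: Ld_def power2_eq_square)
qed

lemma dual_fun_upper: "d z \<le> d y - res (umin y) \<bullet> (z - y)"
  using dual_fun_le[OF umin_minimizes(1), of z y]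
  by (simp add: dual_fun_eq inner_simps inner_commute)

text \<open>Strong convexity of the Lagrangian at multiplier \<open>y\<close> pays for the displacement of the
  minimiser, and Young's inequality turns the coupling term into a square of \<open>norm (z - y)\<close>.\<close>
lemma dual_fun_lower: "d y - res (umin y) \<bullet> (z - y) - Ld / 2 * (norm (z - y))\<^sup>2 \<le> d z"
proof -
  define n where "n = norm (umin z - umin y)"
  define w where "w = onorm (\<lambda>u. G *v u) * norm (z - y)"
  have "(z - y) \<bullet> (res (umin z) - res (umin y))
      \<le> norm (z - y) * norm (res (umin z) - res (umin y))"
    by (rule norm_cauchy_schwarz)
  also have "\<dots> \<le> norm (z - y) * (onorm (\<lambda>u. G *v u) * n)"
    unfolding n_def by (intro mult_left_mono norm_res_diff_le) simp
  finally have "(z - y) \<bullet> (res (umin z) - res (umin y)) \<le> w * n"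
    by (simp add: w_def mult_ac)
  also have "\<dots> \<le> \<sigma> / 2 * n\<^sup>2 + w\<^sup>2 / (2 * \<sigma>)"
  proof -
    have "0 \<le> (\<sigma> * n - w)\<^sup>2 / (2 * \<sigma>)" using \<sigma>_pos by simp
    then show ?thesis using \<sigma>_pos by (simp add: field_simps power2_eq_square)
  qed
  also have "w\<^sup>2 / (2 * \<sigma>) = Ld / 2 * (norm (z - y))\<^sup>2"
    using \<sigma>_pos by (simp add: w_def Ld_def field_simps power2_eq_square)
  finally show ?thesis
    using lagrangian_growth[OF umin_minimizes(1), of y z]
    by (simp add: dual_fun_eq[of z] n_def inner_simps inner_commute)
qed

section \<open>The regularised dual function\<close>

text \<open>The gradient of the regularised dual function, see \<open>gradient_reg_dual\<close>.\<close>
definition "reg_grad x0 \<delta> y = - res (umin y) - \<delta> *\<^sub>R (y - x0)"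

lemma reg_dual_upper:
  "reg_dual f G g U x0 \<delta> z
    \<le> reg_dual f G g U x0 \<delta> y + reg_grad x0 \<delta> y \<bullet> (z - y) - \<delta> / 2 * (norm (z - y))\<^sup>2"
proof -
  have "\<delta> / 2 * (norm (z - x0))\<^sup>2
      = \<delta> / 2 * (norm (y - x0))\<^sup>2 + \<delta> * ((y - x0) \<bullet> (z - y)) + \<delta> / 2 * (norm (z - y))\<^sup>2"
    unfolding power2_norm_eq_inner by (simp add: inner_simps inner_commute algebra_simps)
  moreover have "reg_grad x0 \<delta> y \<bullet> (z - y)
      = - (res (umin y) \<bullet> (z - y)) - \<delta> * ((y - x0) \<bullet> (z - y))"
    by (simp add: reg_grad_def inner_diff_left)
  ultimately show ?thesis using dual_fun_upper[of z y] unfolding reg_dual_def by linarith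
qed

lemma reg_dual_lower:
  "reg_dual f G g U x0 \<delta> y + reg_grad x0 \<delta> y \<bullet> (z - y) - (Ld + \<delta>) / 2 * (norm (z - y))\<^sup>2
    \<le> reg_dual f G g U x0 \<delta> z"
proof -
  have "\<delta> / 2 * (norm (z - x0))\<^sup>2
      = \<delta> / 2 * (norm (y - x0))\<^sup>2 + \<delta> * ((y - x0) \<bullet> (z - y)) + \<delta> / 2 * (norm (z - y))\<^sup>2"
    unfolding power2_norm_eq_inner by (simp add: inner_simps inner_commute algebra_simps)
  moreover have "(Ld + \<delta>) / 2 * (norm (z - y))\<^sup>2
      = Ld / 2 * (norm (z - y))\<^sup>2 + \<delta> / 2 * (norm (z - y))\<^sup>2"
    by (simp add: algebra_simps)
  moreover have "reg_grad x0 \<delta> y \<bullet> (z - y)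
      = - (res (umin y) \<bullet> (z - y)) - \<delta> * ((y - x0) \<bullet> (z - y))"
    by (simp add: reg_grad_def inner_diff_left)
  ultimately show ?thesis using dual_fun_lower[of y z] unfolding reg_dual_def by linarith
qed

lemma reg_dual_gderiv:
  assumes "\<delta> \<ge> 0"
  shows "GDERIV (reg_dual f G g U x0 \<delta>) y :> reg_grad x0 \<delta> y"
proof (rule gderiv_of_quadratic_bound[where c = "(Ld + \<delta>) / 2"])
  fix z
  have "0 \<le> \<delta> / 2 * (norm (z - y))\<^sup>2" "0 \<le> (Ld + \<delta>) / 2 * (norm (z - y))\<^sup>2"
    using assms Ld_nonneg by simp_all
  then show "\<bar>reg_dual f G g U x0 \<delta> z - reg_dual f G g U x0 \<delta> y - reg_grad x0 \<delta> y \<bullet> (z - y)\<bar>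
      \<le> (Ld + \<delta>) / 2 * (norm (z - y))\<^sup>2"
    using reg_dual_upper[of x0 \<delta> z y] reg_dual_lower[of x0 \<delta> y z] unfolding abs_le_iff by linarith
qed

lemma gradient_reg_dual: "\<delta> \<ge> 0 \<Longrightarrow> gradient (reg_dual f G g U x0 \<delta>) y = reg_grad x0 \<delta> y"
  by (intro gradient_eqI reg_dual_gderiv)

lemma reg_dual_maximizer_exists:
  assumes "\<delta> > 0" "closed Q" "x0 \<in> Q"
  shows "\<exists>m\<in>Q. \<forall>z\<in>Q. reg_dual f G g U x0 \<delta> z \<le> reg_dual f G g U x0 \<delta> m"
proof -
  let ?r = "reg_dual f G g U x0 \<delta>" and ?p = "reg_grad x0 \<delta> x0"
  have "continuous_on Q ?r"
    using reg_dual_gderiv[of \<delta> x0] \<open>\<delta> > 0\<close> unfolding gderiv_def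
    by (intro continuous_at_imp_continuous_on ballI has_derivative_continuous) auto
  then have cont: "continuous_on Q (\<lambda>z. - ?r z)" by (rule continuous_on_minus)
  have "- ?r x0 \<le> - ?r z" if "2 * norm ?p / \<delta> < dist x0 z" for z
  proof -
    have "norm ?p \<le> \<delta> / 2 * norm (z - x0)"
      using that \<open>\<delta> > 0\<close> by (simp add: dist_norm norm_minus_commute field_simps)
    then have "norm ?p * norm (z - x0) \<le> \<delta> / 2 * norm (z - x0) * norm (z - x0)"
      by (rule mult_right_mono) simp
    then have "?p \<bullet> (z - x0) \<le> \<delta> / 2 * (norm (z - x0))\<^sup>2"
      using norm_cauchy_schwarz[of ?p "z - x0"] by (simp add: power2_eq_square)
    then show ?thesis using reg_dual_upper[of x0 \<delta> z x0] by linarith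
  qed
  then have "\<exists>m\<in>Q. \<forall>z\<in>Q. - ?r m \<le> - ?r z"
    by (intro attains_min_on_closed_if_coercive[OF cont \<open>closed Q\<close> \<open>x0 \<in> Q\<close>])
  then show ?thesis by simp
qed

lemma reg_dual_growth_at_max:
  assumes "\<delta> \<ge> 0" "convex Q" "m \<in> Q" "z \<in> Q"
    and max: "\<And>z. z \<in> Q \<Longrightarrow> reg_dual f G g U x0 \<delta> z \<le> reg_dual f G g U x0 \<delta> m"
  shows "reg_grad x0 \<delta> m \<bullet> (z - m) \<le> 0"
    "reg_dual f G g U x0 \<delta> z + \<delta> / 2 * (norm (z - m))\<^sup>2 \<le> reg_dual f G g U x0 \<delta> m"
proof -
  have "- reg_dual f G g U x0 \<delta> w \<le> - reg_dual f G g U x0 \<delta> m + - reg_grad x0 \<delta> m \<bullet> (w - m)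
      + (Ld + \<delta>) / 2 * (norm (w - m))\<^sup>2" for w
    using reg_dual_lower[of x0 \<delta> m w] by (simp add: inner_simps)
  then have "0 \<le> - reg_grad x0 \<delta> m \<bullet> (z - m)"
    using max by (intro first_order_optimality[where Q = Q and m = m and z = z
        and \<phi> = "\<lambda>z. - reg_dual f G g U x0 \<delta> z" and L = "Ld + \<delta>"] assms) auto
  then show *: "reg_grad x0 \<delta> m \<bullet> (z - m) \<le> 0" by simp
  show "reg_dual f G g U x0 \<delta> z + \<delta> / 2 * (norm (z - m))\<^sup>2 \<le> reg_dual f G g U x0 \<delta> m"
    using reg_dual_upper[of x0 \<delta> z m] * by linarith
qed

end

section \<open>Duality\<close>

lemma dual_cone_closed: "closed (dual_cone K)"
proof -
  have "dual_cone K = (\<Inter>z\<in>K. {x. 0 \<le> z \<bullet> x})" by (auto simp: dual_cone_def inner_commute)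
  then show ?thesis by (simp add: closed_INT closed_halfspace_ge)
qed

lemma dual_cone_convex_cone: "convex_cone (dual_cone K)"
  by (auto simp: convex_cone_iff dual_cone_def inner_simps)

text \<open>A hyperplane separating a point from the cone can be moved to the origin, and its normal
  then is an element of the dual cone that has negative inner product with the point.\<close>
lemma dual_cone_dual_cone_subset:
  fixes K :: "'a::euclidean_space set"
  assumes "convex_cone K" "closed K"
  shows "dual_cone (dual_cone K) \<subseteq> K"
proof (rule subsetI, rule ccontr)
  fix s assume s: "s \<in> dual_cone (dual_cone K)" and "s \<notin> K"
  have "convex K" using \<open>convex_cone K\<close> by (simp add: convex_cone_def)
  from separating_hyperplane_closed_point[OF this \<open>closed K\<close> \<open>s \<notin> K\<close>]
  obtain a b where ab: "a \<bullet> s < b" "\<forall>z\<in>K. b < a \<bullet> z" by blast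
  have "b < 0" using ab(2) convex_cone_contains_0[OF \<open>convex_cone K\<close>] by force
  have "0 \<le> a \<bullet> z" if "z \<in> K" for z
  proof (rule ccontr)
    assume "\<not> 0 \<le> a \<bullet> z"
    \<comment> \<open>The multiple of \<open>z\<close> at which \<open>a\<close> takes the value \<open>b\<close>.\<close>
    then have "(b / (a \<bullet> z)) *\<^sub>R z \<in> K"
      using \<open>b < 0\<close> by (intro convex_cone_scaleR[OF \<open>convex_cone K\<close> _ that]) (simp add: divide_nonpos_neg)
    with ab(2) have "b < a \<bullet> ((b / (a \<bullet> z)) *\<^sub>R z)" by blast
    then show False using \<open>\<not> 0 \<le> a \<bullet> z\<close> by simp
  qed
  then have "a \<in> dual_cone K" by (simp add: dual_cone_def)
  with s have "0 \<le> s \<bullet> a" by (simp add: dual_cone_def)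
  with ab(1) \<open>b < 0\<close> show False by (simp add: inner_commute)
qed

context strongly_convex_program
begin

text \<open>The first-order condition over the cone \<open>dual_cone K\<close>, tested at \<open>0\<close>, at \<open>2 m\<close> and at
  \<open>m + z\<close>, says that the residual shifted by the gradient of the regulariser satisfies the exact
  optimality conditions: it is in the bidual cone and complementary to the multiplier.\<close>
lemma reg_dual_max_kkt:
  assumes K: "convex_cone K" "closed K" and "\<delta> \<ge> 0" "m \<in> dual_cone K"
    and max: "\<And>z. z \<in> dual_cone K \<Longrightarrow> reg_dual f G g U x0 \<delta> z \<le> reg_dual f G g U x0 \<delta> m"
  shows "res (umin m) + \<delta> *\<^sub>R (m - x0) \<in> K" "m \<bullet> (res (umin m) + \<delta> *\<^sub>R (m - x0)) = 0"
proof -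
  define s where "s = res (umin m) + \<delta> *\<^sub>R (m - x0)"
  have conv: "convex (dual_cone K)"
    using dual_cone_convex_cone[of K] by (simp add: convex_cone_def)
  have opt: "0 \<le> s \<bullet> (z - m)" if "z \<in> dual_cone K" for z
  proof -
    have "reg_grad x0 \<delta> m \<bullet> (z - m) = - (s \<bullet> (z - m))"
      by (simp add: reg_grad_def s_def inner_diff_left inner_add_left)
    with reg_dual_growth_at_max(1)[OF \<open>\<delta> \<ge> 0\<close> conv \<open>m \<in> dual_cone K\<close> that max] show ?thesis by simp
  qed
  have "0 \<in> dual_cone K" "m + m \<in> dual_cone K"
    using dual_cone_convex_cone[of K] \<open>m \<in> dual_cone K\<close>
    by (blast intro: convex_cone_contains_0 convex_cone_add)+
  from this[THEN opt] have "s \<bullet> m = 0" by (simp add: inner_simps)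
  then show "m \<bullet> (res (umin m) + \<delta> *\<^sub>R (m - x0)) = 0" by (simp add: s_def inner_commute)
  have "0 \<le> s \<bullet> z" if "z \<in> dual_cone K" for z
  proof -
    have "m + z \<in> dual_cone K"
      using that dual_cone_convex_cone[of K] \<open>m \<in> dual_cone K\<close> by (auto simp: convex_cone_iff)
    from opt[OF this] show ?thesis by simp
  qed
  then have "s \<in> dual_cone (dual_cone K)" by (simp add: dual_cone_def)
  then show "res (umin m) + \<delta> *\<^sub>R (m - x0) \<in> K"
    using dual_cone_dual_cone_subset[OF K] by (auto simp: s_def)
qed

text \<open>Moving from \<open>xs\<close> to \<open>m\<close> cannot increase \<open>d\<close>, so the regularised value can only be
  at least as good at \<open>m\<close> if the penalty there is at most as large.\<close>
lemma reg_dual_max_close: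
  assumes "\<delta> > 0" "xs \<in> dual_solutions f G g K U" "m \<in> dual_cone K"
    and max: "\<And>z. z \<in> dual_cone K \<Longrightarrow> reg_dual f G g U x0 \<delta> z \<le> reg_dual f G g U x0 \<delta> m"
  shows "norm (m - x0) \<le> norm (xs - x0)"
proof -
  have "reg_dual f G g U x0 \<delta> xs \<le> reg_dual f G g U x0 \<delta> m" "d m \<le> d xs"
    using assms by (auto simp: dual_solutions_def)
  then have "\<delta> / 2 * (norm (m - x0))\<^sup>2 \<le> \<delta> / 2 * (norm (xs - x0))\<^sup>2"
    unfolding reg_dual_def by linarith
  then have "(norm (m - x0))\<^sup>2 \<le> (norm (xs - x0))\<^sup>2" using \<open>\<delta> > 0\<close> by simp
  then show ?thesis by (rule power2_le_imp_le) simp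
qed

text \<open>At the maximiser \<open>m\<close> of the regularised dual the infeasibility is the gradient
  \<open>\<delta> (m - x0)\<close> of the regulariser, and \<open>d\<close> is within \<open>\<delta> P\<^sup>2 / 2\<close> of its maximum \<open>F\<close>.
  Since the minimiser of the Lagrangian depends Lipschitz continuously on the multiplier, a nearby
  \<open>x\<close> with a nearly maximal value inherits both estimates; its primal value is
  \<open>d x + x \<bullet> res (umin x)\<close>.\<close>
lemma primal_recovery:
  assumes K: "convex_cone K" "closed K" and "\<delta> > 0" "m \<in> dual_cone K"
    and max: "\<And>z. z \<in> dual_cone K \<Longrightarrow> reg_dual f G g U x0 \<delta> z \<le> reg_dual f G g U x0 \<delta> m"
    and xs: "xs \<in> dual_solutions f G g K U" "d xs = F" "norm (xs - x0) = P"
    and "x \<in> dual_cone K" and near: "norm (x - m) \<le> \<eta>"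
    and gap: "reg_dual f G g U x0 \<delta> m - reg_dual f G g U x0 \<delta> x \<le> \<gamma>"
  shows "infdist (G *v umin x + g) K \<le> \<delta> * P + Ld * \<eta>"
    and "\<bar>f (umin x) - F\<bar> \<le> \<delta> / 2 * P\<^sup>2 + \<gamma> + \<delta> * (norm x0 + P) * P
        + \<eta> * (norm (res (umin x0)) + Ld * (P + \<eta>)) + (norm x0 + P) * Ld * \<eta>"
proof -
  let ?s = "res (umin m) + \<delta> *\<^sub>R (m - x0)"
  have mP: "norm (m - x0) \<le> P" using reg_dual_max_close[OF \<open>\<delta> > 0\<close> xs(1) assms(4) max] xs(3) by simp
  have "\<delta> \<ge> 0" "0 \<le> \<eta>" using \<open>\<delta> > 0\<close> near norm_ge_zero[of "x - m"] by linarith+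
  have "0 \<le> P" using xs(3) by auto
  note s = reg_dual_max_kkt[OF K \<open>\<delta> \<ge> 0\<close> \<open>m \<in> dual_cone K\<close> max]
  have lip: "norm (res (umin x) - res (umin m)) \<le> Ld * \<eta>"
    using res_umin_lipschitz[of x m] mult_left_mono[OF near Ld_nonneg] by linarith
  have "dist (res (umin x)) ?s \<le> norm (res (umin x) - res (umin m)) + norm (\<delta> *\<^sub>R (m - x0))"
    using norm_triangle_ineq4[of "res (umin x) - res (umin m)" "\<delta> *\<^sub>R (m - x0)"]
    by (simp add: dist_norm diff_diff_eq)
  also have "\<dots> \<le> Ld * \<eta> + \<delta> * P"
    using lip mP \<open>\<delta> > 0\<close> by (intro add_mono) auto
  finally show "infdist (G *v umin x + g) K \<le> \<delta> * P + Ld * \<eta>"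
    using infdist_le2[OF s(1)] by (simp add: res_def add.commute)
  have normm: "norm m \<le> norm x0 + P" using mP norm_triangle_sub[of m x0] by linarith
  have "norm (res (umin x)) \<le> norm (res (umin x0)) + norm (res (umin x) - res (umin x0))"
    by (rule norm_triangle_sub)
  also have "norm (res (umin x) - res (umin x0)) \<le> Ld * (P + \<eta>)"
  proof -
    have "norm (x - x0) \<le> P + \<eta>"
      using norm_triangle_ineq[of "x - m" "m - x0"] near mP by simp
    then show ?thesis
      using res_umin_lipschitz[of x x0] mult_left_mono[OF _ Ld_nonneg] by (meson order_trans)
  qed
  finally have normres: "norm (res (umin x)) \<le> norm (res (umin x0)) + Ld * (P + \<eta>)" by simp
  have split: "x \<bullet> res (umin x) = (x - m) \<bullet> res (umin x) + m \<bullet> (res (umin x) - res (umin m))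
      + - (\<delta> * (m \<bullet> (m - x0)))"
    using s(2) by (simp add: inner_simps)
  have "\<bar>(x - m) \<bullet> res (umin x)\<bar> \<le> norm (x - m) * norm (res (umin x))"
    by (rule Cauchy_Schwarz_ineq2)
  also have "\<dots> \<le> \<eta> * (norm (res (umin x0)) + Ld * (P + \<eta>))"
    using near normres \<open>0 \<le> \<eta>\<close> by (intro mult_mono) auto
  finally have t1: "\<bar>(x - m) \<bullet> res (umin x)\<bar> \<le> \<eta> * (norm (res (umin x0)) + Ld * (P + \<eta>))" .
  have "\<bar>m \<bullet> (res (umin x) - res (umin m))\<bar> \<le> norm m * norm (res (umin x) - res (umin m))"
    by (rule Cauchy_Schwarz_ineq2)
  also have "\<dots> \<le> (norm x0 + P) * (Ld * \<eta>)"
    using normm lip \<open>0 \<le> P\<close> by (intro mult_mono) auto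
  finally have t2: "\<bar>m \<bullet> (res (umin x) - res (umin m))\<bar> \<le> (norm x0 + P) * Ld * \<eta>" by simp
  have "\<bar>m \<bullet> (m - x0)\<bar> \<le> norm m * norm (m - x0)" by (rule Cauchy_Schwarz_ineq2)
  also have "\<dots> \<le> (norm x0 + P) * P" using normm mP \<open>0 \<le> P\<close> by (intro mult_mono) auto
  finally have t3: "\<bar>- (\<delta> * (m \<bullet> (m - x0)))\<bar> \<le> \<delta> * (norm x0 + P) * P"
    using \<open>\<delta> > 0\<close> by (simp add: abs_mult)
  have "d x \<le> F" using xs \<open>x \<in> dual_cone K\<close> by (auto simp: dual_solutions_def)
  moreover have "F - \<delta> / 2 * P\<^sup>2 - \<gamma> \<le> d x"
  proof -
    have "reg_dual f G g U x0 \<delta> xs \<le> reg_dual f G g U x0 \<delta> m"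
      using xs by (intro max) (simp add: dual_solutions_def)
    moreover have "0 \<le> \<delta> / 2 * (norm (x - x0))\<^sup>2" using \<open>\<delta> > 0\<close> by simp
    ultimately show ?thesis using gap xs(2,3) unfolding reg_dual_def[of f G g U x0 \<delta> x]
        reg_dual_def[of f G g U x0 \<delta> xs] by simp
  qed
  ultimately have t4: "\<bar>d x - F\<bar> \<le> \<delta> / 2 * P\<^sup>2 + \<gamma>" by linarith
  have "f (umin x) - F = (d x - F) + x \<bullet> res (umin x)" by (simp add: dual_fun_eq)
  with split t1 t2 t3 t4 show "\<bar>f (umin x) - F\<bar> \<le> \<delta> / 2 * P\<^sup>2 + \<gamma> + \<delta> * (norm x0 + P) * P
        + \<eta> * (norm (res (umin x0)) + Ld * (P + \<eta>)) + (norm x0 + P) * Ld * \<eta>"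
    by linarith
qed

section \<open>Iteration complexity\<close>

lemma dfg_dual_gap:
  assumes dfg: "dfg_iterates f \<sigma> G g K U x0 \<delta> x y u" and "\<delta> > 0" "x0 \<in> dual_cone K"
    and "m \<in> dual_cone K"
  shows "x k \<in> dual_cone K"
    and "reg_dual f G g U x0 \<delta> m - reg_dual f G g U x0 \<delta> (x k)
      \<le> (1 - sqrt (\<delta> / (Ld + \<delta>))) ^ k *
        (reg_dual f G g U x0 \<delta> m - d x0 + \<delta> / 2 * (norm (x0 - m))\<^sup>2)"
proof -
  let ?r = "reg_dual f G g U x0 \<delta>" and ?L = "Ld + \<delta>"
  have L: "reg_lipschitz G \<sigma> \<delta> = ?L" by (simp add: reg_lipschitz_def Ld_def)
  note D = dfg[unfolded dfg_iterates_def Let_def L]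
  have start: "x 0 = x0" "y 1 = x0" by (rule D[THEN conjunct1] D[THEN conjunct2, THEN conjunct1])+
  have x: "x k = closest_point (dual_cone K) (y k + (1 / ?L) *\<^sub>R gradient ?r (y k))"
    and y: "y (k + 1) = x k + ((sqrt ?L - sqrt \<delta>) / (sqrt ?L + sqrt \<delta>)) *\<^sub>R (x k - x (k - 1))"
    if "k \<ge> 1" for k
    by (rule D[THEN conjunct2, THEN conjunct2, rule_format, OF that, THEN conjunct2, THEN conjunct1]
      D[THEN conjunct2, THEN conjunct2, rule_format, OF that, THEN conjunct2, THEN conjunct2])+
  show "x k \<in> dual_cone K"
    using start(1) x[of k] assms(3) closest_point_in_set[OF dual_cone_closed]
    by (cases "k = 0") auto
  have conv: "convex (dual_cone K)" using dual_cone_convex_cone[of K] by (simp add: convex_cone_def)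
  have "- ?r (x k) - (- ?r m)
      \<le> (1 - sqrt (\<delta> / ?L)) ^ k * (- ?r (x 0) - (- ?r m) + \<delta> / 2 * (norm (x 0 - m))\<^sup>2)"
  proof (rule accelerated_gradient_linear_rate[where \<phi> = "\<lambda>x. - ?r x" and p = "\<lambda>y. - reg_grad x0 \<delta> y"
        and x = x and y = y, OF conv dual_cone_closed \<open>m \<in> dual_cone K\<close>])
    show "x 0 \<in> dual_cone K" "y 1 = x 0" using start \<open>x0 \<in> dual_cone K\<close> by auto
    show "- ?r b + - reg_grad x0 \<delta> b \<bullet> (w - b) + \<delta> / 2 * (norm (w - b))\<^sup>2 \<le> - ?r w" for b w
      using reg_dual_upper[of x0 \<delta> w b] by simp
    show "- ?r w \<le> - ?r b + - reg_grad x0 \<delta> b \<bullet> (w - b) + ?L / 2 * (norm (w - b))\<^sup>2" for b w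
      using reg_dual_lower[of x0 \<delta> b w] by simp
    show "x k = closest_point (dual_cone K) (y k - (1 / ?L) *\<^sub>R - reg_grad x0 \<delta> (y k))"
      if "k \<ge> 1" for k
      using x[OF that] \<open>\<delta> > 0\<close> by (simp add: gradient_reg_dual)
  qed (use y \<open>\<delta> > 0\<close> Ld_nonneg in auto)
  moreover have "?r (x 0) = d x0" using start(1) by (simp add: reg_dual_def)
  ultimately show "?r m - ?r (x k) \<le> (1 - sqrt (\<delta> / ?L)) ^ k * (?r m - d x0 + \<delta> / 2 * (norm (x0 - m))\<^sup>2)"
    by (simp add: start(1))
qed

end

lemma geometric_le_power_of_accuracy:
  fixes \<theta> \<epsilon> :: real
  assumes "0 \<le> \<theta>" "\<theta> \<le> 1" "0 < \<epsilon>" and k: "real N * ln (1 / \<epsilon>) \<le> \<theta> * real k"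
  shows "(1 - \<theta>) ^ k \<le> \<epsilon> ^ N"
proof -
  have "(1 - \<theta>) ^ k \<le> exp (- \<theta>) ^ k"
    using \<open>\<theta> \<le> 1\<close> exp_ge_add_one_self[of "- \<theta>"] by (intro power_mono) simp_all
  also have "\<dots> = exp (real k * - \<theta>)" by (rule exp_of_nat_mult[symmetric])
  also have "\<dots> \<le> exp (real N * ln \<epsilon>)"
    using k \<open>0 < \<epsilon>\<close> by (simp add: ln_div mult.commute)
  also have "\<dots> = \<epsilon> ^ N" using \<open>0 < \<epsilon>\<close> by (simp add: exp_of_nat_mult)
  finally show ?thesis .
qed

theorem theorem4p4:
  fixes f :: "real^'n \<Rightarrow> real" and \<sigma> :: real
    and G :: "real^'n^'p" and g :: "real^'p"
    and K :: "(real^'p) set" and U :: "(real^'n) set" and x0 :: "real^'p"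
  assumes "\<sigma> > 0" and "strongly_convex_on UNIV \<sigma> f"
    and "G \<noteq> 0"
    and "proper_cone K"
    and "U \<noteq> {}" and "closed U" and "convex U"
    and feasible: "feasible_set G g K U \<noteq> {}"
    and multiplier: "\<exists>xs \<in> dual_solutions f G g K U. dual_fun f G g U xs = primal_opt f G g K U"
    and "x0 \<in> dual_cone K"
    and "dual_dist f G g K U x0 > 0"
  shows "\<exists>C1>0. \<exists>C2>0. \<forall>\<epsilon>. 0 < \<epsilon> \<and> \<epsilon> \<le> 1/2 \<longrightarrow>
    (\<forall>x y u. dfg_iterates f \<sigma> G g K U x0 (\<epsilon> / (dual_dist f G g K U x0)\<^sup>2) x y u \<longrightarrow>
      (\<forall>k\<ge>1. real k \<ge> C1 / sqrt \<epsilon> * ln (1 / \<epsilon>) \<longrightarrow>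
        primal_solution f G g K U C2 \<epsilon> (lagr_argmin f G g U (x k))))"
proof -
  interpret strongly_convex_program f \<sigma> G g U by unfold_locales (rule assms)+
  define F where "F = primal_opt f G g K U"
  obtain xs where xs: "xs \<in> dual_solutions f G g K U" "d xs = F"
    using multiplier by (auto simp: F_def)
  have K: "convex_cone K" "closed K" using \<open>proper_cone K\<close> by (auto simp: proper_cone_def)
  define R where "R = dual_dist f G g K U x0"
  define P where "P = norm (xs - x0)"
  define M where "M = norm (res (umin x0))"
  \<comment> \<open>\<open>A\<close> bounds the initial value of the Lyapunov function uniformly in \<open>\<epsilon>\<close>: its distance
    term cancels the penalty of the regularised dual at \<open>m\<close>, as both are measured from \<open>x0\<close>.
    \<open>B \<epsilon>\<close> bounds the distance from \<open>x k\<close> to \<open>m\<close>.\<close>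
  define A where "A = F - d x0"
  define B where "B = R * sqrt (2 * A)"
  \<comment> \<open>An upper bound for \<open>Ld + \<delta>\<close>, as \<open>\<epsilon> \<le> 1/2\<close>.\<close>
  define Lmax where "Lmax = Ld + 1 / (2 * R\<^sup>2)"
  have "R > 0" using assms by (simp add: R_def)
  have "A \<ge> 0" using xs \<open>x0 \<in> dual_cone K\<close> by (auto simp: A_def dual_solutions_def)
  have "B \<ge> 0" "P \<ge> 0" "M \<ge> 0" "Lmax > 0"
    using \<open>R > 0\<close> \<open>A \<ge> 0\<close> Ld_nonneg by (auto simp: B_def P_def M_def Lmax_def intro: add_nonneg_pos)
  \<comment> \<open>The 3 is the power of \<open>\<epsilon>\<close> to which the dual gap is driven: one power is lost to the
    strong concavity modulus, the square root of the other two bounds the distance to \<open>m\<close>.\<close>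
  define C1 where "C1 = 3 * R * sqrt Lmax"
  define Cf where "Cf = P / R\<^sup>2 + Ld * B"
  define Cv where "Cv = P\<^sup>2 / (2 * R\<^sup>2) + A + (norm x0 + P) * P / R\<^sup>2 + B * (M + Ld * (P + B))
      + (norm x0 + P) * Ld * B"
  have "C1 > 0" using \<open>R > 0\<close> \<open>Lmax > 0\<close> by (simp add: C1_def)
  have "Cf \<ge> 0" "Cv \<ge> 0"
    using \<open>R > 0\<close> \<open>A \<ge> 0\<close> \<open>B \<ge> 0\<close> \<open>P \<ge> 0\<close> \<open>M \<ge> 0\<close> Ld_nonneg by (auto simp: Cf_def Cv_def)
  have main: "primal_solution f G g K U (Cf + Cv + 1) \<epsilon> (umin (x k))"
    if \<epsilon>: "0 < \<epsilon>" "\<epsilon> \<le> 1/2" and dfg: "dfg_iterates f \<sigma> G g K U x0 (\<epsilon> / R\<^sup>2) x y u"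
      and k: "C1 / sqrt \<epsilon> * ln (1 / \<epsilon>) \<le> real k" for \<epsilon> x y u k
  proof -
    define \<delta> where "\<delta> = \<epsilon> / R\<^sup>2"
    let ?r = "reg_dual f G g U x0 \<delta>"
    have "\<delta> > 0" using \<open>R > 0\<close> \<epsilon> by (simp add: \<delta>_def)
    obtain m where m: "m \<in> dual_cone K" "\<And>z. z \<in> dual_cone K \<Longrightarrow> ?r z \<le> ?r m"
      using reg_dual_maximizer_exists[OF \<open>\<delta> > 0\<close> dual_cone_closed \<open>x0 \<in> dual_cone K\<close>] by blast
    note gap = dfg_dual_gap[OF dfg[folded \<delta>_def] \<open>\<delta> > 0\<close> \<open>x0 \<in> dual_cone K\<close> m(1), of k]
    define \<theta> where "\<theta> = sqrt (\<delta> / (Ld + \<delta>))"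
    have \<theta>: "0 \<le> \<theta>" "\<theta> \<le> 1" using \<open>\<delta> > 0\<close> Ld_nonneg by (auto simp: \<theta>_def)
    have "sqrt \<epsilon> / (R * sqrt Lmax) = sqrt (\<delta> / Lmax)"
      using \<open>R > 0\<close> by (simp add: \<delta>_def real_sqrt_divide real_sqrt_mult)
    also have "\<dots> \<le> \<theta>"
    proof -
      have "\<delta> \<le> 1 / (2 * R\<^sup>2)" using \<epsilon> \<open>R > 0\<close> by (simp add: \<delta>_def field_simps)
      then show ?thesis
        unfolding \<theta>_def Lmax_def using \<open>\<delta> > 0\<close> Ld_nonneg
        by (intro real_sqrt_le_mono divide_left_mono) (auto intro: add_nonneg_pos)
    qed
    finally have "sqrt \<epsilon> / (R * sqrt Lmax) * real k \<le> \<theta> * real k" by (rule mult_right_mono) simp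
    moreover have "sqrt \<epsilon> / (R * sqrt Lmax) * (C1 / sqrt \<epsilon> * ln (1 / \<epsilon>)) \<le> sqrt \<epsilon> / (R * sqrt Lmax) * real k"
      using k \<epsilon> \<open>R > 0\<close> \<open>Lmax > 0\<close> by (intro mult_left_mono) auto
    moreover have "sqrt \<epsilon> / (R * sqrt Lmax) * (C1 / sqrt \<epsilon> * ln (1 / \<epsilon>)) = 3 * ln (1 / \<epsilon>)"
      using \<open>R > 0\<close> \<open>Lmax > 0\<close> \<epsilon> by (simp add: C1_def)
    ultimately have "3 * ln (1 / \<epsilon>) \<le> \<theta> * real k" by linarith
    then have rate: "(1 - \<theta>) ^ k \<le> \<epsilon> ^ 3"
      using \<theta> \<epsilon> by (intro geometric_le_power_of_accuracy) auto
    have "d m \<le> F" using xs m(1) by (auto simp: dual_solutions_def)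
    then have E0: "?r m - d x0 + \<delta> / 2 * (norm (x0 - m))\<^sup>2 \<le> A"
      by (simp add: reg_dual_def A_def norm_minus_commute)
    have "?r m - ?r (x k) \<le> (1 - \<theta>) ^ k * (?r m - d x0 + \<delta> / 2 * (norm (x0 - m))\<^sup>2)"
      using gap(2) by (simp add: \<theta>_def)
    also have "\<dots> \<le> (1 - \<theta>) ^ k * A" using E0 \<theta> by (intro mult_left_mono) auto
    also have "\<dots> \<le> \<epsilon> ^ 3 * A" using rate \<open>A \<ge> 0\<close> by (rule mult_right_mono)
    finally have gap3: "?r m - ?r (x k) \<le> \<epsilon> ^ 3 * A" .
    have "convex (dual_cone K)" using dual_cone_convex_cone[of K] by (simp add: convex_cone_def)
    from reg_dual_growth_at_max(2)[OF _ this m(1) gap(1) m(2)] \<open>\<delta> > 0\<close> gap3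
    have "\<delta> / 2 * (norm (x k - m))\<^sup>2 \<le> \<epsilon> ^ 3 * A" by simp
    then have "(norm (x k - m))\<^sup>2 \<le> R\<^sup>2 * (2 * A) * \<epsilon>\<^sup>2"
      using \<epsilon> \<open>R > 0\<close> by (simp add: \<delta>_def field_simps power3_eq_cube power2_eq_square)
    also have "\<dots> = (B * \<epsilon>)\<^sup>2" using \<open>A \<ge> 0\<close> by (simp add: B_def power_mult_distrib)
    finally have near: "norm (x k - m) \<le> B * \<epsilon>"
      by (rule power2_le_imp_le) (use \<open>B \<ge> 0\<close> \<epsilon> in simp)
    have "\<epsilon> ^ 3 * A \<le> \<epsilon> * A"
      using \<epsilon> \<open>A \<ge> 0\<close> power_decreasing[of 1 3 \<epsilon>] by (intro mult_right_mono) auto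
    then have gap1: "?r m - ?r (x k) \<le> \<epsilon> * A" using gap3 by linarith
    note rec = primal_recovery[OF K \<open>\<delta> > 0\<close> m xs P_def[symmetric] gap(1) near gap1]
    have "infdist (G *v umin (x k) + g) K \<le> Cf * \<epsilon>"
      using rec(1) by (simp add: Cf_def \<delta>_def algebra_simps)
    moreover have "\<bar>f (umin (x k)) - F\<bar> \<le> Cv * \<epsilon>"
    proof -
      have "B * \<epsilon> * (M + Ld * (P + B * \<epsilon>)) \<le> B * \<epsilon> * (M + Ld * (P + B))"
        using \<open>B \<ge> 0\<close> \<epsilon> Ld_nonneg mult_left_mono[of \<epsilon> 1 B]
        by (intro mult_left_mono add_left_mono) auto
      moreover have "\<delta> / 2 * P\<^sup>2 + \<epsilon> * A + \<delta> * (norm x0 + P) * P + B * \<epsilon> * (M + Ld * (P + B))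
          + (norm x0 + P) * Ld * (B * \<epsilon>) = Cv * \<epsilon>"
        by (simp add: Cv_def \<delta>_def algebra_simps add_divide_distrib)
      ultimately show ?thesis using rec(2) unfolding M_def by linarith
    qed
    moreover have "Cf * \<epsilon> \<le> (Cf + Cv + 1) * \<epsilon>" "Cv * \<epsilon> \<le> (Cf + Cv + 1) * \<epsilon>"
      using \<open>Cf \<ge> 0\<close> \<open>Cv \<ge> 0\<close> \<epsilon> by (auto intro!: mult_right_mono)
    ultimately show ?thesis
      using umin_minimizes(1) unfolding primal_solution_def F_def[symmetric] abs_le_iff
      by (intro conjI; linarith?) auto
  qed
  show ?thesis
    using main \<open>C1 > 0\<close> \<open>Cf \<ge> 0\<close> \<open>Cv \<ge> 0\<close> unfolding R_def[symmetric]
    by (intro exI[of _ C1] conjI exI[of _ "Cf + Cv + 1"]) auto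
qed

end
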